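(* There is an algorithm which takes as input oracles $\mathrm{MQ}(f)$ and $\mathrm{SAMP}(f)$ of some $f:\{0,1\}^n\to\{0,1\}$ with $f^{-1}(1)\ne\emptyset$, a distance parameter $\varepsilon'\in(0,1)$ and a vector $\tilde d\in\{0,1,*\}^n$, makes $\tilde O\big(|\mathsf{Unfixed}(\tilde d)|/\varepsilon'\big)$ calls to $\mathrm{MQ}(f)$ and $\mathrm{SAMP}(f)$, and rejects only when it has found two edges in $\mathsf{Edge}_i$ that violate unateness of $f$ along some coordinate $i\in\mathsf{Unfixed}(\tilde d)$ (i.e. an edge in $\mathsf{Edge}_i^0(f)$ and an edge in $\mathsf{Edge}_i^1(f)$). Furthermore, when $$\sum_{i\in\mathsf{Unfixed}(\tilde d)}\min\big(|\mathsf{Edge}_i^0(f)|,|\mathsf{Edge}_i^1(f)|\big)\ge\varepsilon'|f^{-1}(1)|,$$ the algorithm rejects with probability at least $0.99$.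
   Context: $\mathrm{MQ}(f)$ returns $f(x)$ on query $x$; each call to $\mathrm{SAMP}(f)$ returns an independent uniformly random element of $f^{-1}(1)$. For $x\in\{0,1\}^n$, $x^{(i)}$ is $x$ with the $i$-th bit flipped; $\mathsf{Edge}_i$ is the set of pairs $\{x,x^{(i)}\}$. $\mathsf{Edge}_i^1(f)$ is the set of pairs $\{x,x^{(i)}\}$ with $x_i=0$, $f(x)=0$, $f(x^{(i)})=1$; $\mathsf{Edge}_i^0(f)$ is the set of pairs with $x_i=0$, $f(x)=1$, $f(x^{(i)})=0$. $\mathsf{Unfixed}(\tilde d)=\{i\in[n]:\tilde d_i=*\}$. $\tilde O$ hides polylogarithmic factors. *)

theory Defs
  imports "HOL-Probability.Probability"
begin

text \<open>Points of \<open>{0,1}\<^sup>n\<close> are Boolean lists of length \<open>n\<close>; coordinates are \<open>0, \<dots>, n - 1\<close>.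
  A function \<open>{0,1}\<^sup>n \<rightarrow> {0,1}\<close> is given by \<^typ>\<open>bool list \<Rightarrow> bool\<close>, and only its values on
  \<open>cube n\<close> matter.\<close>

type_synonym point = "bool list"

definition cube :: "nat \<Rightarrow> point set" where
  "cube n = {x. length x = n}"

definition flip :: "nat \<Rightarrow> point \<Rightarrow> point" where
  "flip i x = x[i := \<not> x ! i]"

definition ones :: "nat \<Rightarrow> (point \<Rightarrow> bool) \<Rightarrow> point set" where
  "ones n f = {x \<in> cube n. f x}"

definition Edge1 :: "nat \<Rightarrow> (point \<Rightarrow> bool) \<Rightarrow> nat \<Rightarrow> point set set" where
  "Edge1 n f i = {{x, flip i x} | x. x \<in> cube n \<and> \<not> x ! i \<and> \<not> f x \<and> f (flip i x)}"

definition Edge0 :: "nat \<Rightarrow> (point \<Rightarrow> bool) \<Rightarrow> nat \<Rightarrow> point set set" where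
  "Edge0 n f i = {{x, flip i x} | x. x \<in> cube n \<and> \<not> x ! i \<and> f x \<and> \<not> f (flip i x)}"

text \<open>A vector in \<open>{0,1,*}\<^sup>n\<close> is a \<^typ>\<open>bool option list\<close> of length \<open>n\<close>, with \<^const>\<open>None\<close>
  for \<open>*\<close>.\<close>

definition Unfixed :: "bool option list \<Rightarrow> nat set" where
  "Unfixed d = {i. i < length d \<and> d ! i = None}"

datatype verdict = Accept | Reject

text \<open>A randomized adaptive oracle computation: \<open>MQ x k\<close> queries \<open>x\<close> and continues with
  the answer, \<open>SAMP k\<close> continues with the sampled point, and \<open>Draw m k\<close> uses internal
  randomness to continue with a uniformly random element of \<open>{0, \<dots>, m}\<close>. Being an
  inductive datatype, every computation halts on every path.\<close>

datatype oracle_alg =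
    Halt verdict
  | MQ point "bool \<Rightarrow> oracle_alg"
  | SAMP "point \<Rightarrow> oracle_alg"
  | Draw nat "nat \<Rightarrow> oracle_alg"

text \<open>The joint distribution of the verdict and the transcript of oracle calls. The transcript
  has one entry \<open>(x, f x)\<close> per call, both for \<open>MQ\<close> and for \<open>SAMP\<close> (where the
  label is always \<^const>\<open>True\<close>).\<close>

primrec run :: "nat \<Rightarrow> (point \<Rightarrow> bool) \<Rightarrow> oracle_alg \<Rightarrow> (verdict \<times> (point \<times> bool) list) pmf" where
  "run n f (Halt v) = return_pmf (v, [])"
| "run n f (MQ x k) = map_pmf (\<lambda>(v, t). (v, (x, f x) # t)) (run n f (k (f x)))"
| "run n f (SAMP k) =
     bind_pmf (pmf_of_set (ones n f)) (\<lambda>x. map_pmf (\<lambda>(v, t). (v, (x, True) # t)) (run n f (k x)))"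
| "run n f (Draw m k) = bind_pmf (pmf_of_set {..m}) (\<lambda>j. run n f (k j))"

text \<open>An edge has been found once the oracle answers contain the values at both endpoints.\<close>

definition found :: "(point \<times> bool) list \<Rightarrow> point set \<Rightarrow> bool" where
  "found t e \<longleftrightarrow> e \<subseteq> fst ` set t"

text \<open>The bound hidden in soft-O of \<open>g\<close>: a constant times \<open>g\<close> times a power of \<open>log g\<close>.
  The shift by 2 only keeps the logarithm away from 0 for small \<open>g\<close>.\<close>

definition soft_O_bound :: "real \<Rightarrow> nat \<Rightarrow> real \<Rightarrow> real" where
  "soft_O_bound C k g = C * g * ln (2 + g) ^ k"

end

theory Submission imports Defs begin

text \<open>Sampling \<open>x\<close> from \<open>ones n f\<close> and querying \<open>flip i x\<close> reveals an edge of \<open>Edge0 n f i\<close>, and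
  likewise of \<open>Edge1 n f i\<close>, with probability at least
  \<open>p i = min (card (Edge0 n f i)) (card (Edge1 n f i)) / card (ones n f)\<close>. Hence about \<open>1 / p i\<close>
  samples expose a violation along \<open>i\<close>, but \<open>p i\<close> is unknown. With \<open>g = card (Unfixed d) / \<epsilon>\<close>,
  the algorithm therefore spends, at each scale \<open>2 ^ j\<close> up to about \<open>2 * g\<close>, a budget of order \<open>g\<close>
  on trials of \<open>2 * 2 ^ j\<close> samples along a random coordinate, so that there are order \<open>g / 2 ^ j\<close>
  trials. A coordinate with \<open>p i\<close> close to \<open>1 / 2 ^ j\<close> makes a trial at scale \<open>2 ^ j\<close> succeed with
  constant probability; the expected number of successful trials is thus at least a constant
  times \<open>g * (\<Sum>i. p i) / card (Unfixed d)\<close>, up to coordinates with \<open>p i\<close> too small to matter, and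
  the failure probability is exponentially small in it.\<close>

section \<open>The algorithm: trials, schedule and tester\<close>

primrec trial :: "nat \<Rightarrow> nat \<Rightarrow> bool \<Rightarrow> bool \<Rightarrow> oracle_alg \<Rightarrow> oracle_alg" where
  "trial i 0 b0 b1 k = (if b0 \<and> b1 then Halt Reject else k)"
| "trial i (Suc s) b0 b1 k =
     SAMP (\<lambda>x. MQ (flip i x) (\<lambda>y. trial i s (b0 \<or> \<not> x ! i \<and> \<not> y) (b1 \<or> x ! i \<and> \<not> y) k))"

text \<open>Coordinates are drawn with replacement, independently for each trial. The remaining
  trials are passed as the continuation, so a trial that does not reject falls through to
  them.\<close>

primrec trials :: "nat list \<Rightarrow> nat list \<Rightarrow> oracle_alg" where
  "trials us [] = Halt Accept"
| "trials us (s # ss) =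
     Draw (length us - 1) (\<lambda>j. trial (us ! j) s False False (trials us ss))"

text \<open>Trial length times number of trials is about \<open>2 * R\<close> at every scale. The
  factor 2 in the length drives the chance of missing one kind of edge below 1/4 once the rate
  reaches \<open>1 / 2 ^ j\<close>.\<close>

definition schedule :: "nat \<Rightarrow> real \<Rightarrow> nat list" where
  "schedule L R = concat (map (\<lambda>j. replicate (nat \<lceil>R / 2 ^ j\<rceil>) (2 * 2 ^ j)) [0..<Suc L])"

text \<open>The empty case is separate because there is then no coordinate to draw. The finest scale
  resolves rates down to \<open>1 / (2 * g)\<close>; the factor 48 makes the final exponent
  6.\<close>

definition unate_tester :: "real \<Rightarrow> bool option list \<Rightarrow> oracle_alg" where
  "unate_tester \<epsilon> d =
     (if Unfixed d = {} then Halt Accept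
      else let g = real (card (Unfixed d)) / \<epsilon>
           in trials (sorted_list_of_set (Unfixed d)) (schedule (nat \<lceil>log 2 (2 * g)\<rceil>) (48 * g)))"

section \<open>Edges and their satisfying endpoints\<close>

text \<open>A bichromatic edge has exactly one endpoint in \<open>ones n f\<close>, and only that
  endpoint can be sampled. One \<open>SAMP\<close> thus reveals an edge of
  \<open>Edge0 n f i\<close> with probability \<open>card (ends0 n f i) / card (ones n f)\<close>;
  \<open>ends1\<close> plays the same role for \<open>Edge1\<close>.\<close>

definition ends0 :: "nat \<Rightarrow> (point \<Rightarrow> bool) \<Rightarrow> nat \<Rightarrow> point set" where
  "ends0 n f i = {x \<in> ones n f. \<not> x ! i \<and> \<not> f (flip i x)}"

definition ends1 :: "nat \<Rightarrow> (point \<Rightarrow> bool) \<Rightarrow> nat \<Rightarrow> point set" where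
  "ends1 n f i = {x \<in> ones n f. x ! i \<and> \<not> f (flip i x)}"

lemma flip_in_cube_iff [simp]: "flip i x \<in> cube n \<longleftrightarrow> x \<in> cube n"
  by (simp add: flip_def cube_def)

lemma flip_flip [simp]: "flip i (flip i x) = x"
  by (cases "i < length x") (simp_all add: flip_def list_update_beyond)

lemma nth_flip: "x \<in> cube n \<Longrightarrow> i < n \<Longrightarrow> flip i x ! i \<longleftrightarrow> \<not> x ! i"
  by (simp add: flip_def cube_def)

lemma finite_ones [simp]: "finite (ones n f)"
proof (rule finite_subset)
  show "ones n f \<subseteq> {x. set x \<subseteq> UNIV \<and> length x = n}"
    by (auto simp: ones_def cube_def)
qed (rule finite_lists_length_eq, simp)

lemma ends0_edge: "x \<in> ends0 n f i \<Longrightarrow> {x, flip i x} \<in> Edge0 n f i"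
  by (auto simp: ends0_def Edge0_def ones_def)

lemma ends1_edge:
  assumes "x \<in> ends1 n f i" "i < n"
  shows "{x, flip i x} \<in> Edge1 n f i"
proof -
  \<comment> \<open>\<open>Edge1\<close> describes an edge from its endpoint with bit 0, which here
    is \<open>flip i x\<close>, not the sampled \<open>x\<close>.\<close>
  have "{x, flip i x} = {flip i x, flip i (flip i x)}" by auto
  moreover have "flip i x \<in> cube n" "\<not> flip i x ! i" "\<not> f (flip i x)" "f (flip i (flip i x))"
    using assms by (auto simp: ends1_def ones_def nth_flip)
  ultimately show ?thesis
    unfolding Edge1_def mem_Collect_eq by (intro exI[of _ "flip i x"] conjI)
qed

text \<open>Joining each satisfying endpoint to its neighbour maps onto the edges. This turns edge
  counts into lower bounds on sampling probabilities.\<close>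

lemma card_Edge0_le: "card (Edge0 n f i) \<le> card (ends0 n f i)"
proof (rule surj_card_le)
  show "Edge0 n f i \<subseteq> (\<lambda>x. {x, flip i x}) ` ends0 n f i"
    by (auto simp: Edge0_def ends0_def ones_def)
qed (simp add: ends0_def)

lemma card_Edge1_le:
  assumes "i < n"
  shows "card (Edge1 n f i) \<le> card (ends1 n f i)"
proof (rule surj_card_le)
  show "Edge1 n f i \<subseteq> (\<lambda>x. {x, flip i x}) ` ends1 n f i"
  proof
    fix e assume "e \<in> Edge1 n f i"
    then obtain x where x: "e = {x, flip i x}" "x \<in> cube n" "\<not> x ! i" "\<not> f x" "f (flip i x)"
      by (auto simp: Edge1_def)
    then have "flip i x \<in> ends1 n f i" "e = {flip i x, flip i (flip i x)}"
      using assms by (auto simp: ends1_def ones_def nth_flip)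
    then show "e \<in> (\<lambda>x. {x, flip i x}) ` ends1 n f i" by blast
  qed
qed (simp add: ends1_def)

section \<open>Transcripts\<close>

definition violation_along :: "nat \<Rightarrow> (point \<Rightarrow> bool) \<Rightarrow> nat \<Rightarrow> (point \<times> bool) list \<Rightarrow> bool" where
  "violation_along n f i t \<longleftrightarrow> (\<exists>e0 \<in> Edge0 n f i. \<exists>e1 \<in> Edge1 n f i. found t e0 \<and> found t e1)"

lemma found_mono: "found t e \<Longrightarrow> set t \<subseteq> set t' \<Longrightarrow> found t' e"
  unfolding found_def by blast

lemma violation_along_mono:
  "violation_along n f i t \<Longrightarrow> set t \<subseteq> set t' \<Longrightarrow> violation_along n f i t'"
  unfolding violation_along_def by (meson found_mono)

text \<open>Peels off one sample and its query. Since \<open>x\<close> lies in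
  \<open>ones n f\<close>, the flag updates become membership in \<open>ends0\<close> and
  \<open>ends1\<close>.\<close>

lemma set_pmf_run_trial_Suc:
  assumes "ones n f \<noteq> {}" "(v, t) \<in> set_pmf (run n f (trial i (Suc s) b0 b1 k))"
  obtains x t' where "x \<in> ones n f" "t = (x, True) # (flip i x, f (flip i x)) # t'"
    "(v, t') \<in> set_pmf (run n f
       (trial i s (b0 \<or> x \<in> ends0 n f i) (b1 \<or> x \<in> ends1 n f i) k))"
proof -
  from assms obtain x t' where x: "x \<in> ones n f" "t = (x, True) # (flip i x, f (flip i x)) # t'"
    "(v, t') \<in> set_pmf (run n f (trial i s (b0 \<or> \<not> x ! i \<and> \<not> f (flip i x))
       (b1 \<or> x ! i \<and> \<not> f (flip i x)) k))"
    by (auto simp: set_pmf_of_set)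
  then show ?thesis using that by (auto simp: ends0_def ends1_def)
qed

lemma run_trial_cube:
  assumes "ones n f \<noteq> {}"
    and "\<And>v t. (v, t) \<in> set_pmf (run n f k) \<Longrightarrow> fst ` set t \<subseteq> cube n"
    and "(v, t) \<in> set_pmf (run n f (trial i s b0 b1 k))"
  shows "fst ` set t \<subseteq> cube n"
  using assms(3)
proof (induction s arbitrary: b0 b1 t)
  case 0
  then show ?case using assms(2) by (auto split: if_splits)
next
  case (Suc s)
  obtain x t' where x: "x \<in> ones n f" "t = (x, True) # (flip i x, f (flip i x)) # t'" and
    t': "(v, t') \<in> set_pmf (run n f
       (trial i s (b0 \<or> x \<in> ends0 n f i) (b1 \<or> x \<in> ends1 n f i) k))"
    by (rule set_pmf_run_trial_Suc[OF assms(1) Suc.prems])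
  from x Suc.IH[OF t'] show ?case by (simp add: ones_def)
qed

lemma run_trial_length:
  assumes "ones n f \<noteq> {}"
    and "\<And>v t. (v, t) \<in> set_pmf (run n f k) \<Longrightarrow> length t \<le> l"
    and "(v, t) \<in> set_pmf (run n f (trial i s b0 b1 k))"
  shows "length t \<le> 2 * s + l"
  using assms(3)
proof (induction s arbitrary: b0 b1 t)
  case 0
  then show ?case using assms(2) by (auto split: if_splits)
next
  case (Suc s)
  obtain x t' where x: "x \<in> ones n f" "t = (x, True) # (flip i x, f (flip i x)) # t'" and
    t': "(v, t') \<in> set_pmf (run n f
       (trial i s (b0 \<or> x \<in> ends0 n f i) (b1 \<or> x \<in> ends1 n f i) k))"
    by (rule set_pmf_run_trial_Suc[OF assms(1) Suc.prems])
  from x Suc.IH[OF t'] show ?case by simp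
qed

text \<open>The flags appear as alternatives because, in mid-trial, a set flag is witnessed by an
  earlier part of the transcript. The last alternative covers a rejection in the continuation, whose
  transcript is a suffix.\<close>

lemma run_trial_Reject:
  assumes "ones n f \<noteq> {}" "i < n"
    and "(Reject, t) \<in> set_pmf (run n f (trial i s b0 b1 k))"
  shows "(b0 \<or> (\<exists>e \<in> Edge0 n f i. found t e)) \<and> (b1 \<or> (\<exists>e \<in> Edge1 n f i. found t e)) \<or>
    (\<exists>t'. (Reject, t') \<in> set_pmf (run n f k) \<and> set t' \<subseteq> set t)"
  using assms(3)
proof (induction s arbitrary: b0 b1 t)
  case 0
  then show ?case by (auto split: if_splits)
next
  case (Suc s)
  obtain x t' where x: "t = (x, True) # (flip i x, f (flip i x)) # t'" and
    t': "(Reject, t') \<in> set_pmf (run n f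
       (trial i s (b0 \<or> x \<in> ends0 n f i) (b1 \<or> x \<in> ends1 n f i) k))"
    by (rule set_pmf_run_trial_Suc[OF assms(1) Suc.prems])
  have sub: "set t' \<subseteq> set t" and edge: "found t {x, flip i x}"
    by (auto simp: x found_def)
  have "\<exists>e \<in> Edge0 n f i. found t e" if "x \<in> ends0 n f i"
    using ends0_edge[OF that] edge by blast
  moreover have "\<exists>e \<in> Edge1 n f i. found t e" if "x \<in> ends1 n f i"
    using ends1_edge[OF that assms(2)] edge by blast
  moreover have "\<exists>e \<in> E. found t e" if "\<exists>e \<in> E. found t' e" for E
    using that found_mono[OF _ sub] by blast
  ultimately show ?case
    using Suc.IH[OF t']
  proof (elim disjE)
    assume "\<exists>t''. (Reject, t'') \<in> set_pmf (run n f k) \<and> set t'' \<subseteq> set t'"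
    then show ?thesis using sub by blast
  qed blast
qed

lemma set_pmf_run_trials_Cons:
  assumes "us \<noteq> []" "z \<in> set_pmf (run n f (trials us (s # ss)))"
  obtains i where "i \<in> set us" "z \<in> set_pmf (run n f (trial i s False False (trials us ss)))"
proof -
  from assms(2) obtain j where j: "j \<le> length us - 1"
    "z \<in> set_pmf (run n f (trial (us ! j) s False False (trials us ss)))"
    by (auto simp: set_pmf_of_set)
  moreover have "us ! j \<in> set us"
  proof -
    \<comment> \<open>\<open>Draw\<close> includes its upper end, so \<open>length us - 1\<close>
      gives exactly the valid indices of a nonempty list.\<close>
    have "j < length us" using assms(1) j by (cases us) auto
    then show ?thesis by (rule nth_mem)
  qed
  ultimately show ?thesis using that by blast
qed

lemma run_trials_cube:
  assumes "ones n f \<noteq> {}" "us \<noteq> []" "(v, t) \<in> set_pmf (run n f (trials us ss))"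
  shows "fst ` set t \<subseteq> cube n"
  using assms(3)
proof (induction ss arbitrary: v t)
  case (Cons s ss)
  obtain i where i: "(v, t) \<in> set_pmf (run n f (trial i s False False (trials us ss)))"
    by (rule set_pmf_run_trials_Cons[OF assms(2) Cons.prems])
  show ?case by (rule run_trial_cube[OF assms(1) Cons.IH i])
qed simp

lemma run_trials_length:
  assumes "ones n f \<noteq> {}" "us \<noteq> []" "(v, t) \<in> set_pmf (run n f (trials us ss))"
  shows "length t \<le> 2 * sum_list ss"
  using assms(3)
proof (induction ss arbitrary: v t)
  case (Cons s ss)
  obtain i where i: "(v, t) \<in> set_pmf (run n f (trial i s False False (trials us ss)))"
    by (rule set_pmf_run_trials_Cons[OF assms(2) Cons.prems])
  show ?case using run_trial_length[OF assms(1) Cons.IH i] by simp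
qed simp

lemma run_trials_Reject:
  assumes "ones n f \<noteq> {}" "us \<noteq> []" "set us \<subseteq> {..<n}"
    and "(Reject, t) \<in> set_pmf (run n f (trials us ss))"
  shows "\<exists>i \<in> set us. violation_along n f i t"
  using assms(4)
proof (induction ss arbitrary: t)
  case (Cons s ss)
  obtain i where i: "i \<in> set us"
    "(Reject, t) \<in> set_pmf (run n f (trial i s False False (trials us ss)))"
    by (rule set_pmf_run_trials_Cons[OF assms(2) Cons.prems])
  then have "i < n" using assms(3) by auto
  from run_trial_Reject[OF assms(1) this i(2)] show ?case
  proof
    assume "\<exists>t'. (Reject, t') \<in> set_pmf (run n f (trials us ss)) \<and> set t' \<subseteq> set t"
    then show ?case using Cons.IH violation_along_mono by meson
  qed (use i(1) in \<open>auto simp: violation_along_def\<close>)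
qed simp

section \<open>Acceptance probabilities\<close>

text \<open>Acceptance is tracked instead of rejection because it requires every trial to miss, so
  bounds for successive trials multiply.\<close>

definition accept_prob :: "nat \<Rightarrow> (point \<Rightarrow> bool) \<Rightarrow> oracle_alg \<Rightarrow> real" where
  "accept_prob n f A = pmf (map_pmf fst (run n f A)) Accept"

lemma accept_prob_nonneg [simp]: "0 \<le> accept_prob n f A"
  by (simp add: accept_prob_def)

lemma accept_prob_Halt [simp]: "accept_prob n f (Halt v) = (if v = Accept then 1 else 0)"
  by (simp add: accept_prob_def)

lemma accept_prob_MQ [simp]: "accept_prob n f (MQ x k) = accept_prob n f (k (f x))"
  by (simp add: accept_prob_def pmf.map_comp comp_def case_prod_unfold)

lemma accept_prob_SAMP [simp]:
  assumes "ones n f \<noteq> {}"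
  shows "accept_prob n f (SAMP k) =
    (\<Sum>x \<in> ones n f. accept_prob n f (k x)) / real (card (ones n f))"
  using assms
  by (simp add: accept_prob_def map_bind_pmf pmf.map_comp comp_def case_prod_unfold
      pmf_bind_pmf_of_set)

lemma accept_prob_Draw [simp]:
  "accept_prob n f (Draw m k) = (\<Sum>j \<le> m. accept_prob n f (k j)) / real (Suc m)"
  by (simp add: accept_prob_def map_bind_pmf pmf_bind_pmf_of_set)

lemma prob_Reject:
  "measure_pmf.prob (run n f A) {(v, t). v = Reject} = 1 - accept_prob n f A"
proof -
  have "{(v, t). v = Reject} = space (measure_pmf (run n f A)) - fst -` {Accept}"
    by (auto intro: verdict.exhaust)
  then show ?thesis
    using measure_pmf.prob_compl[of "fst -` {Accept}" "run n f A"]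
    by (simp add: accept_prob_def pmf_map)
qed

text \<open>One uniform sample misses \<open>H\<close> with probability
  \<open>1 - card H / card S\<close>; the flag \<open>b\<close> says that \<open>H\<close> was hit
  before.\<close>

lemma average_miss:
  fixes c :: real
  assumes "finite S" "H \<subseteq> S" "S \<noteq> {}"
  shows "(\<Sum>x \<in> S. if b \<or> x \<in> H then 0 else c) / real (card S) =
    (if b then 0 else (1 - real (card H) / real (card S)) * c)"
proof (cases b)
  case False
  have "(\<Sum>x \<in> S. if b \<or> x \<in> H then 0 else c) = (\<Sum>x \<in> S - H. c)"
    using False assms(1) by (intro sum.mono_neutral_cong_right) auto
  also have "\<dots> = (real (card S) - real (card H)) * c"
    using assms by (simp add: card_Diff_subset finite_subset of_nat_diff card_mono)
  finally show ?thesis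
    using False assms by (simp add: field_simps)
qed simp

text \<open>Union bound: the continuation is reached only if one of the two kinds of edge is missed
  by all samples, and a flag already set removes its term. The flags stay general because the
  induction changes them.\<close>

lemma accept_prob_trial_le:
  assumes "ones n f \<noteq> {}"
  defines "N \<equiv> real (card (ones n f))"
  shows "accept_prob n f (trial i s b0 b1 k) \<le> accept_prob n f k *
    ((if b0 then 0 else (1 - card (ends0 n f i) / N) ^ s) +
     (if b1 then 0 else (1 - card (ends1 n f i) / N) ^ s))"
proof (induction s arbitrary: b0 b1)
  case (Suc s)
  let ?c0 = "(1 - card (ends0 n f i) / N) ^ s" and ?c1 = "(1 - card (ends1 n f i) / N) ^ s"
  have N: "0 < N" using assms by (simp add: card_gt_0_iff)
  have sub: "ends0 n f i \<subseteq> ones n f" "ends1 n f i \<subseteq> ones n f"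
    by (auto simp: ends0_def ends1_def)
  have "accept_prob n f (trial i (Suc s) b0 b1 k) =
      (\<Sum>x \<in> ones n f. accept_prob n f
         (trial i s (b0 \<or> x \<in> ends0 n f i) (b1 \<or> x \<in> ends1 n f i) k)) / N"
    using assms by (auto intro!: sum.cong simp: ends0_def ends1_def)
  also have "\<dots> \<le> (\<Sum>x \<in> ones n f. accept_prob n f k *
      ((if b0 \<or> x \<in> ends0 n f i then 0 else ?c0) + (if b1 \<or> x \<in> ends1 n f i then 0 else ?c1))) / N"
    using N by (intro divide_right_mono sum_mono Suc.IH) simp
  also have "\<dots> = accept_prob n f k *
      ((\<Sum>x \<in> ones n f. if b0 \<or> x \<in> ends0 n f i then 0 else ?c0) / N +
       (\<Sum>x \<in> ones n f. if b1 \<or> x \<in> ends1 n f i then 0 else ?c1) / N)"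
    by (simp only: sum_distrib_left[symmetric] sum.distrib add_divide_distrib[symmetric]
        times_divide_eq_right)
  also have "\<dots> = accept_prob n f k *
      ((if b0 then 0 else (1 - card (ends0 n f i) / N) * ?c0) +
       (if b1 then 0 else (1 - card (ends1 n f i) / N) * ?c1))"
    unfolding N_def average_miss[OF finite_ones sub(1) assms(1)]
      average_miss[OF finite_ones sub(2) assms(1)] ..
  finally show ?case by (simp only: power_Suc)
qed simp

text \<open>The union bound may exceed 1; this trivial bound then takes over and justifies the
  \<open>min 1\<close> in \<open>success\<close>.\<close>

lemma accept_prob_trial_le_cont:
  assumes "ones n f \<noteq> {}"
  shows "accept_prob n f (trial i s b0 b1 k) \<le> accept_prob n f k"
proof (induction s arbitrary: b0 b1)
  case (Suc s)
  have N: "0 < real (card (ones n f))" using assms by (simp add: card_gt_0_iff)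
  have "accept_prob n f (trial i (Suc s) b0 b1 k) \<le>
      (\<Sum>x \<in> ones n f. accept_prob n f k) / real (card (ones n f))"
    unfolding trial.simps accept_prob_SAMP[OF assms] accept_prob_MQ
    using N by (intro divide_right_mono sum_mono Suc.IH) simp
  moreover have "\<dots> = accept_prob n f k" using assms N by simp
  ultimately show ?case by simp
qed simp

text \<open>A common lower bound for the probabilities of sampling a point of \<open>ends0\<close>
  and one of \<open>ends1\<close>.\<close>

definition edge_rate :: "nat \<Rightarrow> (point \<Rightarrow> bool) \<Rightarrow> nat \<Rightarrow> real" where
  "edge_rate n f i = real (min (card (Edge0 n f i)) (card (Edge1 n f i))) / real (card (ones n f))"

text \<open>Lower bound for the chance that \<open>s\<close> samples reveal both kinds of edge at
  rate \<open>p\<close>, clipped to stay nonnegative.\<close>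

definition success :: "real \<Rightarrow> nat \<Rightarrow> real" where
  "success p s = 1 - min 1 (2 * (1 - p) ^ s)"

lemma success_nonneg: "0 \<le> success p s"
  by (simp add: success_def)

lemma edge_rate_bounds:
  assumes "i < n"
  shows "0 \<le> edge_rate n f i" "edge_rate n f i \<le> 1"
    "edge_rate n f i \<le> card (ends0 n f i) / card (ones n f)"
    "edge_rate n f i \<le> card (ends1 n f i) / card (ones n f)"
proof -
  show "0 \<le> edge_rate n f i" by (simp add: edge_rate_def)
  show *: "edge_rate n f i \<le> card (ends0 n f i) / card (ones n f)"
    unfolding edge_rate_def using card_Edge0_le[of n f i]
    by (intro divide_right_mono) auto
  show "edge_rate n f i \<le> card (ends1 n f i) / card (ones n f)"
    unfolding edge_rate_def using card_Edge1_le[OF assms, of f]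
    by (intro divide_right_mono) auto
  have "card (ends0 n f i) \<le> card (ones n f)"
    by (intro card_mono) (auto simp: ends0_def)
  then have "card (ends0 n f i) / card (ones n f) \<le> 1"
    by (simp add: divide_le_eq_1 flip: neq0_conv)
  with * show "edge_rate n f i \<le> 1" by linarith
qed

lemma accept_prob_trial:
  assumes "ones n f \<noteq> {}" "i < n"
  shows "accept_prob n f (trial i s False False k) \<le>
    accept_prob n f k * (1 - success (edge_rate n f i) s)"
proof -
  let ?p = "edge_rate n f i" and ?N = "real (card (ones n f))"
  have le: "card (ends0 n f i) / ?N \<le> 1" "card (ends1 n f i) / ?N \<le> 1"
    using assms(1)
    by (auto simp: divide_le_eq_1 card_gt_0_iff ends0_def ends1_def intro!: card_mono)
  note b = edge_rate_bounds[OF assms(2), of f]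
  have "(1 - card (ends0 n f i) / ?N) ^ s + (1 - card (ends1 n f i) / ?N) ^ s \<le>
      (1 - ?p) ^ s + (1 - ?p) ^ s"
    using b le by (intro add_mono power_mono) auto
  then have "accept_prob n f (trial i s False False k) \<le> accept_prob n f k * (2 * (1 - ?p) ^ s)"
    using accept_prob_trial_le[OF assms(1), of i s False False k]
    by (elim order_trans) (auto intro: mult_left_mono)
  moreover note accept_prob_trial_le_cont[OF assms(1), of i s False False k]
  ultimately show ?thesis by (simp add: success_def min_def)
qed

text \<open>Each trial multiplies the bound by \<open>1 - q\<close>, where \<open>q\<close> is the
  success bound averaged over the random coordinate, and \<open>1 - q \<le> exp (- q)\<close> turns
  the product into a sum in the exponent. Distinctness turns the average over indices into one over
  coordinates.\<close>

lemma accept_prob_trials: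
  assumes "ones n f \<noteq> {}" "us \<noteq> []" "distinct us" "set us \<subseteq> {..<n}"
  shows "accept_prob n f (trials us ss) \<le>
    exp (- (\<Sum>s \<leftarrow> ss. (\<Sum>i \<in> set us. success (edge_rate n f i) s) / real (length us)))"
proof (induction ss)
  case (Cons s ss)
  let ?m = "real (length us)" and ?a = "accept_prob n f (trials us ss)"
  let ?q = "(\<Sum>i \<in> set us. success (edge_rate n f i) s) / ?m"
  have m: "0 < ?m" and card: "card (set us) = length us"
    using assms by (auto simp: distinct_card)
  have "{..length us - 1} = {..<length us}" using assms(2) by (cases us) auto
  then have "accept_prob n f (trials us (s # ss)) =
      (\<Sum>j < length us. accept_prob n f (trial (us ! j) s False False (trials us ss))) / ?m"
    using assms(2) by (simp add: of_nat_diff Suc_le_eq)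
  also have "\<dots> = (\<Sum>i \<in> set us. accept_prob n f (trial i s False False (trials us ss))) / ?m"
    using sum.reindex_bij_betw[OF bij_betw_nth[OF assms(3) refl refl],
        of "\<lambda>i. accept_prob n f (trial i s False False (trials us ss))"] by simp
  also have "\<dots> \<le> (\<Sum>i \<in> set us. ?a * (1 - success (edge_rate n f i) s)) / ?m"
    using assms m by (intro divide_right_mono sum_mono accept_prob_trial) auto
  also have "\<dots> = ?a * (1 - ?q)"
    using m card by (simp add: sum_distrib_left[symmetric] sum_subtractf field_simps)
  also have "\<dots> \<le> ?a * exp (- ?q)"
    using exp_ge_add_one_self[of "- ?q"] by (intro mult_left_mono) auto
  also have "\<dots> \<le> exp (- (\<Sum>s \<leftarrow> ss. (\<Sum>i \<in> set us. success (edge_rate n f i) s) / ?m)) * exp (- ?q)"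
    using Cons.IH by (intro mult_right_mono) auto
  also have "\<dots> =
      exp (- (\<Sum>s \<leftarrow> s # ss. (\<Sum>i \<in> set us. success (edge_rate n f i) s) / ?m))"
    by (simp flip: exp_add)
  finally show ?case .
qed simp

section \<open>The schedule\<close>

lemma sum_list_concat_replicate:
  fixes F :: "'a \<Rightarrow> 'b :: semiring_1"
  shows "(\<Sum>s \<leftarrow> concat (map (\<lambda>j. replicate (r j) (c j)) js). F s) =
    (\<Sum>j \<leftarrow> js. of_nat (r j) * F (c j))"
  by (induction js) (simp_all add: sum_list_replicate)

lemma sum_list_schedule:
  fixes F :: "nat \<Rightarrow> 'a :: semiring_1"
  shows "(\<Sum>s \<leftarrow> schedule L R. F s) = (\<Sum>j \<le> L. of_nat (nat \<lceil>R / 2 ^ j\<rceil>) * F (2 * 2 ^ j))"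
proof -
  have "(\<Sum>s \<leftarrow> schedule L R. F s) =
      (\<Sum>j \<leftarrow> [0..<Suc L]. of_nat (nat \<lceil>R / 2 ^ j\<rceil>) * F (2 * 2 ^ j))"
    unfolding schedule_def by (rule sum_list_concat_replicate)
  also have "\<dots> = (\<Sum>j \<in> set [0..<Suc L]. of_nat (nat \<lceil>R / 2 ^ j\<rceil>) * F (2 * 2 ^ j))"
    by (rule sum_list_distinct_conv_sum_set) simp
  also have "set [0..<Suc L] = {..L}" by auto
  finally show ?thesis .
qed

text \<open>Rounding up adds at most one trial per scale, hence at most \<open>2 * 2 ^ j\<close>
  samples.\<close>

lemma schedule_length:
  assumes "0 \<le> R"
  shows "real (sum_list (schedule L R)) \<le> 2 * real (Suc L) * (R + 2 ^ L)"
proof -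
  have "sum_list (schedule L R) = (\<Sum>j \<le> L. nat \<lceil>R / 2 ^ j\<rceil> * (2 * 2 ^ j))"
    using sum_list_schedule[of "\<lambda>s. s" L R] by simp
  then have "real (sum_list (schedule L R)) = (\<Sum>j \<le> L. real (nat \<lceil>R / 2 ^ j\<rceil>) * (2 * 2 ^ j))"
    by simp
  also have "\<dots> \<le> (\<Sum>j \<le> L. 2 * (R + 2 ^ L))"
  proof (rule sum_mono)
    fix j assume j: "j \<in> {..L}"
    have "real (nat \<lceil>R / 2 ^ j\<rceil>) \<le> R / 2 ^ j + 1"
      using assms by (simp add: of_nat_nat)
    then have "real (nat \<lceil>R / 2 ^ j\<rceil>) * (2 * 2 ^ j) \<le> (R / 2 ^ j + 1) * (2 * 2 ^ j)"
      by (intro mult_right_mono) auto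
    also have "\<dots> = 2 * (R + 2 ^ j)" by (simp add: field_simps)
    also have "\<dots> \<le> 2 * (R + 2 ^ L)"
      using j by (simp add: power_increasing)
    finally show "real (nat \<lceil>R / 2 ^ j\<rceil>) * (2 * 2 ^ j) \<le> 2 * (R + 2 ^ L)" .
  qed
  finally show ?thesis by (simp add: algebra_simps)
qed

text \<open>Each kind of edge is missed with probability at most
  \<open>exp (- 2) \<le> 1 / 4\<close>; doubling for the two kinds leaves success at least
  1/2.\<close>

lemma success_at_scale:
  assumes "1 / 2 ^ j \<le> p" "p \<le> 1"
  shows "1 / 2 \<le> success p (2 * 2 ^ j)"
proof -
  have "(1 - p) ^ (2 * 2 ^ j) \<le> exp (- p) ^ (2 * 2 ^ j)"
    using assms exp_ge_add_one_self[of "- p"] by (intro power_mono) auto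
  also have "\<dots> = exp (- (2 * (2 ^ j * p)))"
    by (simp add: exp_of_nat_mult[symmetric] algebra_simps)
  also have "\<dots> \<le> exp (- 2)"
    using assms by (simp add: field_simps)
  also have "\<dots> \<le> 1 / 4"
  proof -
    have "(2 :: real) * 2 \<le> exp 1 * exp 1"
      using exp_ge_add_one_self[of 1] by (intro mult_mono) auto
    then show ?thesis by (simp add: exp_minus exp_add[symmetric] field_simps)
  qed
  finally show ?thesis by (simp add: success_def)
qed

text \<open>The single scale with \<open>1 / 2 ^ j\<close> within a factor 2 below \<open>p\<close>
  already contributes at least \<open>p / 4\<close>. Subtracting \<open>\<delta>\<close> covers
  rates too small for any scale and keeps the bound linear in \<open>p\<close>, ready for
  summation.\<close>

lemma weighted_success:
  assumes "0 \<le> p" "p \<le> 1" "1 / 2 ^ L \<le> \<delta>"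
  shows "(p - \<delta>) / 4 \<le> (\<Sum>j \<le> L. success p (2 * 2 ^ j) / 2 ^ j)"
proof (cases "p \<le> \<delta>")
  case True
  then have "(p - \<delta>) / 4 \<le> 0" by simp
  also have "0 \<le> (\<Sum>j \<le> L. success p (2 * 2 ^ j) / 2 ^ j)"
    by (intro sum_nonneg divide_nonneg_nonneg success_nonneg) simp
  finally show ?thesis .
next
  case False
  define j where "j = (LEAST j. 1 / 2 ^ j \<le> p)"
  have L: "1 / 2 ^ L \<le> p" using False assms(3) by linarith
  then have j: "1 / 2 ^ j \<le> p" and "j \<le> L"
    unfolding j_def by (rule LeastI, rule Least_le)
  \<comment> \<open>Minimality gives \<open>p < 1 / 2 ^ (j - 1)\<close> for positive
    \<open>j\<close>; for \<open>j = 0\<close> the bound follows from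
    \<open>p \<le> 1\<close>.\<close>
  have "p \<le> 2 / 2 ^ j"
  proof (cases j)
    case (Suc i)
    then have "\<not> 1 / 2 ^ i \<le> p" using not_less_Least[of i "\<lambda>j. 1 / 2 ^ j \<le> p"] j_def by simp
    then show ?thesis using Suc by simp
  qed (use assms in simp)
  moreover have "0 \<le> \<delta>"
    using assms(3) by (rule order_trans[rotated]) simp
  ultimately have "(p - \<delta>) / 4 \<le> (1 / 2) / 2 ^ j" by simp
  also have "\<dots> \<le> success p (2 * 2 ^ j) / 2 ^ j"
    by (intro divide_right_mono success_at_scale j assms) simp
  also have "\<dots> \<le> (\<Sum>j \<le> L. success p (2 * 2 ^ j) / 2 ^ j)"
    using \<open>j \<le> L\<close> by (intro member_le_sum divide_nonneg_nonneg success_nonneg) auto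
  finally show ?thesis .
qed

lemma schedule_success:
  assumes "finite U" "U \<noteq> {}" "\<And>i. i \<in> U \<Longrightarrow> 0 \<le> p i \<and> p i \<le> 1"
    and "\<epsilon> \<le> (\<Sum>i \<in> U. p i)" "1 / 2 ^ L \<le> \<epsilon> / (2 * real (card U))" "0 \<le> R"
  shows "R * \<epsilon> / (8 * real (card U)) \<le>
    (\<Sum>s \<leftarrow> schedule L R. (\<Sum>i \<in> U. success (p i) s) / real (card U))"
proof -
  let ?m = "real (card U)" and ?\<delta> = "\<epsilon> / (2 * real (card U))"
  have m: "0 < ?m" using assms by (simp add: card_gt_0_iff)
  \<comment> \<open>Subtracting \<open>?\<delta>\<close> once per coordinate costs half of
    \<open>\<epsilon>\<close>; the division by 4 leaves an eighth.\<close>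
  have "\<epsilon> / 8 \<le> (\<Sum>i \<in> U. (p i - ?\<delta>) / 4)"
  proof -
    have "(\<Sum>i \<in> U. (p i - ?\<delta>) / 4) = ((\<Sum>i \<in> U. p i) - ?m * ?\<delta>) / 4"
      by (simp add: sum_subtractf flip: sum_divide_distrib)
    moreover have "?m * ?\<delta> = \<epsilon> / 2" using m by simp
    ultimately show ?thesis using assms(4) by simp
  qed
  also have "\<dots> \<le> (\<Sum>i \<in> U. \<Sum>j \<le> L. success (p i) (2 * 2 ^ j) / 2 ^ j)"
    using assms by (intro sum_mono weighted_success) auto
  finally have "(R / ?m) * (\<epsilon> / 8) \<le> (R / ?m) * (\<Sum>i \<in> U. \<Sum>j \<le> L. success (p i) (2 * 2 ^ j) / 2 ^ j)"
    using assms(6) by (intro mult_left_mono) auto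
  also have "\<dots> = (\<Sum>j \<le> L. R / 2 ^ j * ((\<Sum>i \<in> U. success (p i) (2 * 2 ^ j)) / ?m))"
    by (subst sum.swap) (simp add: sum_distrib_left sum_divide_distrib mult_ac)
  also have "\<dots> \<le> (\<Sum>j \<le> L. real (nat \<lceil>R / 2 ^ j\<rceil>) * ((\<Sum>i \<in> U. success (p i) (2 * 2 ^ j)) / ?m))"
    by (intro sum_mono mult_right_mono divide_nonneg_nonneg sum_nonneg success_nonneg)
      (auto simp: real_nat_ceiling_ge)
  finally show ?thesis by (simp add: sum_list_schedule mult_ac)
qed

section \<open>Choice of the finest scale, and the guarantees of the tester\<close>

lemma finite_Unfixed [simp]: "finite (Unfixed d)"
  by (simp add: Unfixed_def)

text \<open>In turn: the finest scale resolves small rates, its cost stays linear in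
  \<open>g\<close>, and the number of scales costs a single logarithm.\<close>

lemma scale_bounds:
  assumes "1 \<le> g"
  defines "L \<equiv> nat \<lceil>log 2 (2 * g)\<rceil>"
  shows "2 * g \<le> 2 ^ L" "2 ^ L \<le> 4 * g" "real (Suc L) \<le> 5 * ln (2 + g)"
proof -
  \<comment> \<open>Nonnegativity of the logarithm ensures that \<open>nat\<close> does not
    truncate.\<close>
  have "log 2 1 \<le> log 2 (2 * g)" using assms by (subst log_le_cancel_iff) auto
  then have L: "log 2 (2 * g) \<le> L" "L \<le> log 2 (2 * g) + 1"
    unfolding L_def by (simp_all add: of_nat_nat)
  have "2 * g = 2 powr log 2 (2 * g)" using assms by simp
  also have "\<dots> \<le> 2 powr L" using L by (intro powr_mono) auto
  finally show "2 * g \<le> 2 ^ L" by (simp add: powr_realpow)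
  have "2 powr L \<le> 2 powr (log 2 (2 * g) + 1)" using L by (intro powr_mono) auto
  also have "\<dots> = 4 * g" using assms by (simp add: powr_add)
  finally show "2 ^ L \<le> 4 * g" by (simp add: powr_realpow)
  have ln2: "1 / 2 \<le> ln (2 :: real)" using ln2_ge_two_thirds by simp
  have "exp 1 \<le> 2 + g" using assms exp_le by linarith
  then have ln1: "1 \<le> ln (2 + g)" using assms by (simp add: ln_ge_iff)
  have "log 2 (2 * g) = 1 + ln g / ln 2"
    using assms by (simp add: log_def ln_mult add_divide_distrib)
  also have "ln g / ln 2 \<le> ln g / (1 / 2)"
    using assms ln2 by (intro divide_left_mono) auto
  also have "\<dots> \<le> 2 * ln (2 + g)" using assms by simp
  finally have "log 2 (2 * g) \<le> 1 + 2 * ln (2 + g)" by simp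
  \<comment> \<open>\<open>L + 1 \<le> 3 + 2 * ln (2 + g)\<close>, and the 3 is absorbed because
    \<open>ln (2 + g) \<ge> 1\<close>.\<close>
  then show "real (Suc L) \<le> 5 * ln (2 + g)" using L ln1 by simp
qed

theorem theorem4p2:
  "\<exists>(A :: real \<Rightarrow> bool option list \<Rightarrow> oracle_alg) (C :: real) (k :: nat).
     \<forall>(n :: nat) (f :: point \<Rightarrow> bool) (\<epsilon> :: real) (d :: bool option list).
       ones n f \<noteq> {} \<longrightarrow> 0 < \<epsilon> \<longrightarrow> \<epsilon> < 1 \<longrightarrow> length d = n \<longrightarrow>
         (\<forall>(v, t) \<in> set_pmf (run n f (A \<epsilon> d)).
            fst ` set t \<subseteq> cube n \<and>
            real (length t) \<le> soft_O_bound C k (real (card (Unfixed d)) / \<epsilon>) \<and>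
            (v = Reject \<longrightarrow>
               (\<exists>i \<in> Unfixed d. \<exists>e0 \<in> Edge0 n f i. \<exists>e1 \<in> Edge1 n f i. found t e0 \<and> found t e1))) \<and>
         ((\<Sum>i \<in> Unfixed d. real (min (card (Edge0 n f i)) (card (Edge1 n f i))))
              \<ge> \<epsilon> * real (card (ones n f)) \<longrightarrow>
            measure_pmf.prob (run n f (A \<epsilon> d)) {(v, t). v = Reject} \<ge> 0.99)"
proof (intro exI[of _ unate_tester] exI[of _ "1040 :: real"] exI[of _ "1 :: nat"] allI impI)
  fix n :: nat and f :: "point \<Rightarrow> bool" and \<epsilon> :: real and d :: "bool option list"
  assume ne: "ones n f \<noteq> {}" and \<epsilon>: "0 < \<epsilon>" "\<epsilon> < 1" and d: "length d = n"
  let ?U = "Unfixed d" and ?N = "real (card (ones n f))"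
  let ?min = "\<lambda>i. real (min (card (Edge0 n f i)) (card (Edge1 n f i)))"
  have N: "0 < ?N" using ne by (simp add: card_gt_0_iff)
  have U: "?U \<subseteq> {..<n}" using d by (auto simp: Unfixed_def)
  show "(\<forall>(v, t) \<in> set_pmf (run n f (unate_tester \<epsilon> d)).
            fst ` set t \<subseteq> cube n \<and>
            real (length t) \<le> soft_O_bound 1040 1 (real (card ?U) / \<epsilon>) \<and>
            (v = Reject \<longrightarrow>
               (\<exists>i \<in> ?U. \<exists>e0 \<in> Edge0 n f i. \<exists>e1 \<in> Edge1 n f i. found t e0 \<and> found t e1))) \<and>
         ((\<Sum>i \<in> ?U. ?min i) \<ge> \<epsilon> * ?N \<longrightarrow>
            measure_pmf.prob (run n f (unate_tester \<epsilon> d)) {(v, t). v = Reject} \<ge> 0.99)"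
  proof (cases "?U = {}")
    case True
    \<comment> \<open>With no unfixed coordinate the sum of minima is 0, so the condition for likely
      rejection cannot hold.\<close>
    moreover have "\<not> \<epsilon> * ?N \<le> 0" using \<epsilon> N by (simp add: not_le)
    ultimately show ?thesis
      by (simp add: unate_tester_def soft_O_bound_def)
  next
    case False
    define m where "m = real (card ?U)"
    define g where "g = m / \<epsilon>"
    define L where "L = nat \<lceil>log 2 (2 * g)\<rceil>"
    define us where "us = sorted_list_of_set ?U"
    have A: "unate_tester \<epsilon> d = trials us (schedule L (48 * g))"
      using False by (simp add: unate_tester_def Let_def g_def L_def us_def m_def)
    have us: "us \<noteq> []" "distinct us" "set us = ?U" "length us = card ?U"
      using False by (auto simp: us_def)
    have m: "1 \<le> m" using False by (simp add: m_def Suc_le_eq card_gt_0_iff)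
    have g: "1 \<le> g" using m \<epsilon> by (simp add: g_def)
    note L = scale_bounds[OF g, folded L_def]
    show ?thesis
    proof (intro conjI impI ballI, clarify)
      fix v t assume run: "(v, t) \<in> set_pmf (run n f (unate_tester \<epsilon> d))"
      note run' = run[unfolded A]
      have "length t \<le> 2 * sum_list (schedule L (48 * g))"
        by (rule run_trials_length[OF ne us(1) run'])
      then have "real (length t) \<le> 2 * real (sum_list (schedule L (48 * g)))"
        by linarith
      also have "\<dots> \<le> 2 * (2 * real (Suc L) * (48 * g + 2 ^ L))"
        using g by (intro mult_left_mono schedule_length) auto
      also have "\<dots> \<le> 2 * (2 * (5 * ln (2 + g)) * (48 * g + 4 * g))"
        using g L by (intro mult_left_mono mult_mono) auto
      \<comment> \<open>The constant is \<open>2 * 2 * 5 * 52\<close>, with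
        \<open>52 = 48 + 4\<close>; one logarithm gives the exponent 1.\<close>
      also have "\<dots> = soft_O_bound 1040 1 (real (card ?U) / \<epsilon>)"
        by (simp add: soft_O_bound_def g_def m_def)
      finally have len: "real (length t) \<le> soft_O_bound 1040 1 (real (card ?U) / \<epsilon>)" .
      show "fst ` set t \<subseteq> cube n \<and>
            real (length t) \<le> soft_O_bound 1040 1 (real (card ?U) / \<epsilon>) \<and>
            (v = Reject \<longrightarrow>
               (\<exists>i \<in> ?U. \<exists>e0 \<in> Edge0 n f i. \<exists>e1 \<in> Edge1 n f i. found t e0 \<and> found t e1))"
        using run_trials_cube[OF ne us(1) run'] len
          run_trials_Reject[OF ne us(1), of t "schedule L (48 * g)"] run' us(3) U
        unfolding violation_along_def by metis
    next
      assume "\<epsilon> * ?N \<le> (\<Sum>i \<in> ?U. ?min i)"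
      then have sum: "\<epsilon> \<le> (\<Sum>i \<in> ?U. edge_rate n f i)"
        using N by (simp add: edge_rate_def sum_divide_distrib[symmetric] field_simps)
      have "0 < 2 * g" using g by simp
      then have "1 / 2 ^ L \<le> 1 / (2 * g)"
        using L(1) by (intro divide_left_mono) auto
      also have "\<dots> = \<epsilon> / (2 * real (card ?U))"
        by (simp add: g_def m_def)
      finally have fine: "1 / 2 ^ L \<le> \<epsilon> / (2 * real (card ?U))" .
      \<comment> \<open>Since \<open>g * \<epsilon> = m\<close>, the exponent supplied by
        \<open>schedule_success\<close> is \<open>48 / 8\<close>.\<close>
      have "6 = 48 * g * \<epsilon> / (8 * real (card ?U))"
        using m \<epsilon> False by (simp add: g_def m_def)
      also have "\<dots> \<le> (\<Sum>s \<leftarrow> schedule L (48 * g).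
          (\<Sum>i \<in> ?U. success (edge_rate n f i) s) / real (card ?U))"
        using False sum fine g U edge_rate_bounds(1,2)[of _ n f]
        by (intro schedule_success) auto
      finally have "accept_prob n f (unate_tester \<epsilon> d) \<le> exp (- 6)"
        using accept_prob_trials[OF ne us(1,2), of "schedule L (48 * g)"] U us(3,4)
        unfolding A by (auto elim: order_trans)
      also have "exp (- 6 :: real) \<le> 0.01"
      proof -
        \<comment> \<open>The quadratic Taylor bound \<open>1 + 1 + 1 / 2\<close> suffices, as
          \<open>(5 / 2) ^ 6\<close> exceeds 100.\<close>
        have "(5 / 2 :: real) \<le> exp 1"
          using exp_lower_Taylor_quadratic[of 1] by simp
        then have "(5 / 2 :: real) ^ 6 \<le> exp 1 ^ 6" by (intro power_mono) auto
        also have "\<dots> = exp 6" using exp_of_nat_mult[of 6 "1 :: real"] by simp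
        finally show ?thesis by (simp add: exp_minus field_simps)
      qed
      finally show "0.99 \<le> measure_pmf.prob (run n f (unate_tester \<epsilon> d)) {(v, t). v = Reject}"
        by (simp add: prob_Reject)
    qed
  qed
qed

end
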